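(* Let $\mathscr R$ be the supertropical real $\nu$-semifield$^\dagger$ and $\Lambda=\{\lambda_1,\dots,\lambda_n\}$. There is a $1:1$, order-reversing correspondence $$\{\text{principal }1^\nu\text{-sets of }\mathscr R^{(n)}\}\leftrightarrow\{\text{principal }\nu\text{-kernels of }\langle\mathscr R\rangle\text{ that are }\mathcal K\text{-kernels}\},$$ given by $Z\mapsto\mathcal Kern_{\langle\mathscr R\rangle}(Z)$; the reverse map is given by $K\mapsto1_{\mathrm{loc}}(K)$.
   Context: **Supertropical reals.** $\mathscr R=\mathcal T\sqcup\mathcal G$, where $\mathcal T$ is the ordered group $(\mathbb R,+)$ written multiplicatively (unit $1$) and $\mathcal G$ is a second (ghost) copy; $\nu:\mathscr R\to\mathcal G$, $a\mapsto a^\nu$, is the identity on $\mathcal G$ and the identification on $\mathcal T$; $ab^\nu=a^\nu b=a^\nu b^\nu=(ab)^\nu$; and $a+b$ is whichever of $a,b$ has larger $\nu$-value, or $a^\nu$ if $a^\nu=b^\nu$. Write $a\cong_\nu b$ if $a^\nu=b^\nu$ and $a\ge_\nu b$ if $a^\nu\ge b^\nu$. For $a\in\mathcal T$ put $a^*=a^{-1}$, $(a^\nu)^*=(a^{-1})^\nu$. **Rational functions.** $\mathscr R(\Lambda)$ consists of the functions $\mathscr R^{(n)}\to\mathscr R$ of the form $\mathbf a\mapsto h(\mathbf a)g(\mathbf a)^*$ with $h$ a polynomial over $\mathscr R$ and $g$ a polynomial with tangible coefficients, with pointwise operations. **Kernels.** A $\nu$-kernel of $\mathscr R(\Lambda)$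 is a subgroup $K$ (closed under products and $*$) such that $a,b\in K$, $\alpha+\beta\cong_\nu1$ imply $\alpha a+\beta b\in K$; these are handled up to $\cong_\nu$. $\langle S\rangle$ is the $\nu$-kernel generated by $S$; principal means generated by one element; $\langle\mathscr R\rangle$ is the $\nu$-kernel generated by the constants, and a $\nu$-kernel of $\langle\mathscr R\rangle$ is a $\nu$-kernel of $\mathscr R(\Lambda)$ contained in it. $1_{\mathrm{loc}}(S)=\{\mathbf a\in\mathscr R^{(n)}: f(\mathbf a)\cong_\nu1\ \forall f\in S\}$; a $1^\nu$-set is a set of this form, principal if it equals $1_{\mathrm{loc}}(f)$ for one $f\in\mathscr R(\Lambda)$. $\mathcal Kern_{\langle\mathscr R\rangle}(Z)=\{f\in\langle\mathscr R\rangle: f(\mathbf a)\cong_\nu1\ \forall\mathbf a\in Z\}$. A $\mathcal K$-kernel of $\langle\mathscr R\rangle$ is a $\nu$-kernel of the form $\mathcal Kern_{\langle\mathscr R\rangle}(Z)$ with $Z$ a $1^\nu$-set. *)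

theory Defs
  imports Complex_Main
begin

section \<open>The supertropical reals\<close>

text \<open>
  The tangible group is \<open>(\<real>, +)\<close> written multiplicatively, so the unit is \<open>Tangible 0\<close> and
  the product adds the underlying reals. There is no zero element.
\<close>

datatype supertrop = Tangible real | Ghost real

primrec val :: "supertrop \<Rightarrow> real" where
  "val (Tangible x) = x"
| "val (Ghost x) = x"

definition nu :: "supertrop \<Rightarrow> supertrop" where
  "nu a = Ghost (val a)"

definition nu_eq :: "supertrop \<Rightarrow> supertrop \<Rightarrow> bool" (infix \<open>\<cong>\<^sub>\<nu>\<close> 50) where
  "a \<cong>\<^sub>\<nu> b \<longleftrightarrow> nu a = nu b"

primrec star :: "supertrop \<Rightarrow> supertrop" where
  "star (Tangible x) = Tangible (- x)"
| "star (Ghost x) = Ghost (- x)"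

instantiation supertrop :: "{comm_semiring, comm_monoid_mult}"
begin

definition one_supertrop :: supertrop where
  "1 = Tangible 0"

fun times_supertrop :: "supertrop \<Rightarrow> supertrop \<Rightarrow> supertrop" where
  "Tangible x * Tangible y = Tangible (x + y)"
| "Tangible x * Ghost y = Ghost (x + y)"
| "Ghost x * Tangible y = Ghost (x + y)"
| "Ghost x * Ghost y = Ghost (x + y)"

definition plus_supertrop :: "supertrop \<Rightarrow> supertrop \<Rightarrow> supertrop" where
  "a + b = (if val b < val a then a else if val a < val b then b else nu a)"

instance
proof
  fix a b c :: supertrop
  show "a * b * c = a * (b * c)"
    by (cases a; cases b; cases c) auto
  show "a * b = b * a"
    by (cases a; cases b) auto
  show "1 * a = a"
    by (cases a) (auto simp: one_supertrop_def)
  show "a + b + c = a + (b + c)"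
    by (cases a; cases b; cases c) (auto simp: plus_supertrop_def nu_def)
  show "a + b = b + a"
    by (auto simp: plus_supertrop_def nu_def)
  show "(a + b) * c = a * c + b * c"
    by (cases a; cases b; cases c) (auto simp: plus_supertrop_def nu_def)
qed

end


section \<open>Polynomials and rational functions\<close>

type_synonym 'n point = "'n \<Rightarrow> supertrop"
type_synonym 'n sfun = "'n point \<Rightarrow> supertrop"

definition fun_nu_eq :: "'n sfun \<Rightarrow> 'n sfun \<Rightarrow> bool" (infix \<open>\<approx>\<^sub>\<nu>\<close> 50) where
  "f \<approx>\<^sub>\<nu> g \<longleftrightarrow> (\<forall>a. f a \<cong>\<^sub>\<nu> g a)"

text \<open>
  Sum of a nonempty list. The usual finite sums are unavailable, as there is no zero.
\<close>

fun sum1 :: "supertrop list \<Rightarrow> supertrop" where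
  "sum1 [] = undefined"
| "sum1 [x] = x"
| "sum1 (x # y # zs) = x + sum1 (y # zs)"

text \<open>
  Functions given by polynomials with coefficients in \<open>C\<close>. A polynomial is a nonempty list of
  pairs (coefficient, exponent vector). The exponent vectors are required to be distinct because
  \<open>a + a\<close> is a ghost: a repeated tangible monomial has a ghost coefficient once collected.
\<close>

definition poly_funs :: "supertrop set \<Rightarrow> ('n::finite) sfun set" where
  "poly_funs C =
     {\<lambda>a. sum1 (map (\<lambda>(c, e). c * (\<Prod>i\<in>UNIV. a i ^ e i)) ms) | ms :: (supertrop \<times> ('n \<Rightarrow> nat)) list.
        ms \<noteq> [] \<and> distinct (map snd ms) \<and> fst ` set ms \<subseteq> C}"

definition rat_funs :: "('n::finite) sfun set" where
  "rat_funs = {\<lambda>a. h a * star (g a) | h g. h \<in> poly_funs UNIV \<and> g \<in> poly_funs (range Tangible)}"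


section \<open>Kernels\<close>

definition nu_class :: "('n::finite) sfun \<Rightarrow> 'n sfun set" where
  "nu_class f = {g \<in> rat_funs. g \<approx>\<^sub>\<nu> f}"

text \<open>
  Kernels are taken up to \<open>\<approx>\<^sub>\<nu>\<close>: a kernel is a union of \<open>\<approx>\<^sub>\<nu>\<close>-classes of \<open>rat_funs\<close>, and it
  absorbs the class of each function built by the operations. (A pointwise sum of rational
  functions is in general only \<open>\<approx>\<^sub>\<nu>\<close> to an element of \<open>rat_funs\<close>, since the tangible/ghost
  pattern of the sum need not come from a single fraction.) Closure under single elements,
  i.e. \<open>nu_class f \<subseteq> K\<close> for \<open>f \<in> K\<close>, is the product clause with \<open>g = 1\<close>.
\<close>

definition nu_kernel :: "('n::finite) sfun set \<Rightarrow> bool" where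
  "nu_kernel K \<longleftrightarrow>
     K \<subseteq> rat_funs \<and>
     (\<lambda>_. 1) \<in> K \<and>
     (\<forall>f\<in>K. \<forall>g\<in>K. nu_class (\<lambda>x. f x * g x) \<subseteq> K) \<and>
     (\<forall>f\<in>K. nu_class (\<lambda>x. star (f x)) \<subseteq> K) \<and>
     (\<forall>f\<in>K. \<forall>g\<in>K. \<forall>\<alpha>\<in>rat_funs. \<forall>\<beta>\<in>rat_funs.
        (\<lambda>x. \<alpha> x + \<beta> x) \<approx>\<^sub>\<nu> (\<lambda>_. 1) \<longrightarrow> nu_class (\<lambda>x. \<alpha> x * f x + \<beta> x * g x) \<subseteq> K)"

definition kernel_gen :: "('n::finite) sfun set \<Rightarrow> 'n sfun set" where
  "kernel_gen S = \<Inter>{K. nu_kernel K \<and> S \<subseteq> K}"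

definition const_kernel :: "('n::finite) sfun set" where
  "const_kernel = kernel_gen (range (\<lambda>c _. c))"

definition one_loc :: "'n sfun set \<Rightarrow> 'n point set" where
  "one_loc S = {a. \<forall>f\<in>S. f a \<cong>\<^sub>\<nu> 1}"

definition one_set :: "('n::finite) point set \<Rightarrow> bool" where
  "one_set Z \<longleftrightarrow> (\<exists>S\<subseteq>rat_funs. Z = one_loc S)"

definition principal_one_set :: "('n::finite) point set \<Rightarrow> bool" where
  "principal_one_set Z \<longleftrightarrow> (\<exists>f\<in>rat_funs. Z = one_loc {f})"

definition Kern :: "('n::finite) point set \<Rightarrow> 'n sfun set" where
  "Kern Z = {f \<in> const_kernel. \<forall>a\<in>Z. f a \<cong>\<^sub>\<nu> 1}"

definition nu_kernel_of_const :: "('n::finite) sfun set \<Rightarrow> bool" where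
  "nu_kernel_of_const K \<longleftrightarrow> nu_kernel K \<and> K \<subseteq> const_kernel"

definition principal_kernel :: "('n::finite) sfun set \<Rightarrow> bool" where
  "principal_kernel K \<longleftrightarrow> (\<exists>f\<in>rat_funs. K = kernel_gen {f})"

definition K_kernel :: "('n::finite) sfun set \<Rightarrow> bool" where
  "K_kernel K \<longleftrightarrow> nu_kernel_of_const K \<and> (\<exists>Z. one_set Z \<and> K = Kern Z)"

end

theory Submission
  imports Defs
begin

text \<open>
  Passing to \<open>val\<close> turns rational functions into differences of tropical polynomials, which are
  piecewise affine, and turns \<open>\<nu>\<close>-kernels into convex subgroups: the kernel generated by \<open>f\<close>
  consists of the \<open>g\<close> with \<open>\<bar>g\<bar> \<le> k \<bar>f\<bar>\<close> for some natural number \<open>k\<close>, and the kernel generated by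
  the constants consists of the bounded functions. The key point is that a bounded \<open>h\<close> vanishing on
  the zero set of \<open>f\<close> satisfies \<open>\<bar>h\<bar> \<le> k \<bar>f\<bar>\<close>; on each polyhedron where both are affine this is
  Farkas' lemma. Hence the bounded functions vanishing on the zero set of \<open>f\<close> form the kernel
  generated by \<open>min \<bar>f\<bar> 1\<close>, and the rest is a Galois connection.
\<close>

section \<open>Systems of affine inequalities\<close>

type_synonym 'v aff = "('v \<Rightarrow> real) \<times> real"

definition aff :: "('v::finite) aff \<Rightarrow> ('v \<Rightarrow> real) \<Rightarrow> real" where
  "aff p x = (\<Sum>i\<in>UNIV. fst p i * x i) + snd p"

definition aff_add :: "'v aff \<Rightarrow> 'v aff \<Rightarrow> 'v aff" where
  "aff_add p q = (\<lambda>i. fst p i + fst q i, snd p + snd q)"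

definition aff_scale :: "real \<Rightarrow> 'v aff \<Rightarrow> 'v aff" where
  "aff_scale r p = (\<lambda>i. r * fst p i, r * snd p)"

abbreviation aff_diff :: "'v aff \<Rightarrow> 'v aff \<Rightarrow> 'v aff" where
  "aff_diff p q \<equiv> aff_add p (aff_scale (- 1) q)"

lemma aff_aff_add [simp]: "aff (aff_add p q) x = aff p x + aff q x"
  by (simp add: aff_def aff_add_def sum.distrib algebra_simps)

lemma aff_aff_scale [simp]: "aff (aff_scale r p) x = r * aff p x"
  by (simp add: aff_def aff_scale_def sum_distrib_left algebra_simps)

text \<open>Isolates the dependence on the coordinate about to be eliminated.\<close>

lemma aff_fun_upd: "aff p (x(j := t)) = aff p (x(j := 0)) + fst p j * t"
proof -
  have "(\<Sum>i\<in>UNIV. fst p i * (x(j := t)) i)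
      = (\<Sum>i\<in>UNIV. fst p i * (x(j := 0)) i + (if i = j then fst p j * t else 0))"
    by (rule sum.cong) auto
  then show ?thesis
    by (simp add: aff_def sum.distrib)
qed

text \<open>In a pair \<open>(s, p)\<close> the flag \<open>s\<close> says whether the inequality is strict.\<close>

definition le_flag :: "bool \<Rightarrow> real \<Rightarrow> real \<Rightarrow> bool" where
  "le_flag s a b \<longleftrightarrow> (if s then a < b else a \<le> b)"

definition sat :: "('v::finite \<Rightarrow> real) \<Rightarrow> bool \<times> 'v aff \<Rightarrow> bool" where
  "sat x q \<longleftrightarrow> le_flag (fst q) (aff (snd q) x) 0"

text \<open>Positive combinations of the inequalities in \<open>A\<close>. One strict summand makes
  the sum strict, hence the flag \<open>s \<or> s'\<close>; the factor \<open>r\<close> is positive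
  because a zero factor would destroy strictness.\<close>

inductive_set conic :: "(bool \<times> 'v aff) set \<Rightarrow> (bool \<times> 'v aff) set" for A where
  base: "q \<in> A \<Longrightarrow> q \<in> conic A"
| scale: "(s, p) \<in> conic A \<Longrightarrow> 0 < r \<Longrightarrow> (s, aff_scale r p) \<in> conic A"
| add: "(s, p) \<in> conic A \<Longrightarrow> (s', p') \<in> conic A \<Longrightarrow> (s \<or> s', aff_add p p') \<in> conic A"

lemma conic_trans:
  assumes "q \<in> conic B" and "B \<subseteq> conic A"
  shows "q \<in> conic A"
  using assms(1) by induction (use assms(2) in \<open>auto intro: conic.intros\<close>)

text \<open>The one-variable case. The midpoint of the largest lower and the smallest upper bound
  works: a strict \<open>l\<close> lies strictly below \<open>?u\<close> and weakly below
  \<open>?l\<close>, hence strictly below their mean, and dually for upper bounds.\<close>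

lemma ex_between_flagged:
  assumes "finite L" "finite U"
    and LU: "\<And>s l s' u. (s, l) \<in> L \<Longrightarrow> (s', u) \<in> U \<Longrightarrow> le_flag (s \<or> s') l u"
  shows "\<exists>t. (\<forall>(s, l)\<in>L. le_flag s l t) \<and> (\<forall>(s, u)\<in>U. le_flag s t u)"
proof -
  let ?l = "Max (snd ` L)" and ?u = "Min (snd ` U)"
  have l: "l \<le> ?l" if "(s, l) \<in> L" for s l
    using that assms(1) by (force intro: Max_ge)
  have u: "?u \<le> u" if "(s, u) \<in> U" for s u
    using that assms(2) by (force intro: Min_le)
  show ?thesis
  proof (cases "L = {}"; cases "U = {}")
    assume "L = {}" "U = {}"
    then show ?thesis by simp
  next
    assume "L = {}" "U \<noteq> {}"
    then show ?thesis
      \<comment> \<open>The shift by 1 makes every upper bound hold strictly, whatever its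
        flag.\<close>
      by (intro exI[of _ "?u - 1"]) (force simp: le_flag_def dest: u)
  next
    assume "L \<noteq> {}" "U = {}"
    then show ?thesis
      by (intro exI[of _ "?l + 1"]) (force simp: le_flag_def dest: l)
  next
    assume ne: "L \<noteq> {}" "U \<noteq> {}"
    have "?l \<in> snd ` L" "?u \<in> snd ` U"
      by (rule Max_in Min_in; use assms(1,2) ne in simp)+
    then obtain p q where "p \<in> L" "?l = snd p" "q \<in> U" "?u = snd q"
      by (elim imageE)
    then have sl: "(fst p, ?l) \<in> L" and su: "(fst q, ?u) \<in> U"
      by simp_all
    have le: "?l \<le> ?u"
      using LU[OF sl su] by (auto simp: le_flag_def split: if_splits)
    have "le_flag s l ((?l + ?u) / 2)" if "(s, l) \<in> L" for s l
      using l[OF that] LU[OF that su] le by (auto simp: le_flag_def split: if_splits)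
    moreover have "le_flag s ((?l + ?u) / 2) u" if "(s, u) \<in> U" for s u
      using u[OF that] LU[OF sl that] le by (auto simp: le_flag_def split: if_splits)
    ultimately show ?thesis by blast
  qed
qed

text \<open>Fourier--Motzkin elimination; the set \<open>J\<close> collects the variables not yet eliminated.\<close>

lemma infeasible_certificate_aux:
  fixes A :: "(bool \<times> ('v::finite) aff) set"
  assumes "finite J" and "finite A"
    and "\<And>q i. q \<in> A \<Longrightarrow> i \<notin> J \<Longrightarrow> fst (snd q) i = 0"
    and "\<And>x. \<exists>q\<in>A. \<not> sat x q"
  shows "\<exists>s c. (s, (\<lambda>_. 0, c)) \<in> conic A \<and> \<not> le_flag s c 0"
  using assms
proof (induction J arbitrary: A rule: finite_induct)
  case empty
  obtain q where q: "q \<in> A" "\<not> sat (\<lambda>_. 0) q"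
    using empty by blast
  have "fst (snd q) = (\<lambda>_. 0)"
    using empty(2)[OF q(1)] by auto
  then have "q = (fst q, (\<lambda>_. 0, snd (snd q)))"
    by (metis prod.collapse)
  moreover have "\<not> le_flag (fst q) (snd (snd q)) 0"
    using q(2) by (simp add: sat_def aff_def)
  ultimately show ?case
    using q(1) by (metis conic.base)
next
  case (insert j J)
  define cf where "cf q = fst (snd q) j" for q :: "bool \<times> 'v aff"
  \<comment> \<open>The two multipliers cancel the coefficient of variable \<open>j\<close>; both
    are positive when \<open>p \<in> P\<close> and \<open>q \<in> N\<close>.\<close>
  define comb where
    "comb p q = (fst p \<or> fst q, aff_add (aff_scale (- cf q) (snd p)) (aff_scale (cf p) (snd q)))"
    for p q :: "bool \<times> 'v aff"
  define P where "P = {q \<in> A. 0 < cf q}"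
  define N where "N = {q \<in> A. cf q < 0}"
  define B where "B = {q \<in> A. cf q = 0} \<union> (\<lambda>(p, q). comb p q) ` (P \<times> N)"
  have fin: "finite P" "finite N" "finite B"
    using insert.prems(1) by (auto simp: P_def N_def B_def)
  have "B \<subseteq> conic A"
  proof
    fix q assume "q \<in> B"
    then consider "q \<in> A" | p n where "p \<in> P" "n \<in> N" "q = comb p n"
      by (auto simp: B_def)
    then show "q \<in> conic A"
    proof cases
      case 1
      then show ?thesis by (rule conic.base)
    next
      case 2
      then have "(fst p, snd p) \<in> conic A" "(fst n, snd n) \<in> conic A" "0 < - cf n" "0 < cf p"
        by (auto simp: P_def N_def intro: conic.base)
      then show ?thesis
        unfolding 2(3) comb_def by (intro conic.add conic.scale)
    qed
  qed
  moreover have "\<exists>s c. (s, (\<lambda>_. 0, c)) \<in> conic B \<and> \<not> le_flag s c 0"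
  proof (rule insert.IH[OF fin(3)])
    fix q i assume q: "q \<in> B" and i: "i \<notin> J"
    consider "q \<in> A" "cf q = 0" | p n where "p \<in> A" "n \<in> A" "q = comb p n"
      using q by (auto simp: B_def P_def N_def)
    then show "fst (snd q) i = 0"
    proof cases
      case 1
      then show ?thesis
        using insert.prems(2)[of q i] i by (cases "i = j") (auto simp: cf_def)
    next
      case 2
      then show ?thesis
        using insert.prems(2)[of p i] insert.prems(2)[of n i] i
        by (cases "i = j") (auto simp: comb_def aff_add_def aff_scale_def cf_def)
    qed
  next
    fix x
    show "\<exists>q\<in>B. \<not> sat x q"
    \<comment> \<open>A solution of \<open>B\<close> would give a solution of \<open>A\<close> by
      changing coordinate \<open>j\<close> only.\<close>
    proof (rule ccontr)
      assume "\<not> ?thesis"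
      then have xB: "sat x q" if "q \<in> B" for q
        using that by blast
      define r where "r q = aff (snd q) (x(j := 0))" for q :: "bool \<times> 'v aff"
      have r: "aff (snd q) (x(j := t)) = r q + cf q * t" for q t
        unfolding r_def cf_def by (rule aff_fun_upd)
      have x: "aff (snd q) x = r q + cf q * x j" for q
        using r[of q "x j"] by simp
      \<comment> \<open>Solving \<open>r q + cf q * t\<close> against 0 for \<open>t\<close>: a
        lower bound if \<open>cf q\<close> is negative, an upper bound if it is positive.\<close>
      let ?bd = "\<lambda>q. (fst q, - r q / cf q)"
      have "\<exists>t. (\<forall>(s, l)\<in>?bd ` N. le_flag s l t) \<and> (\<forall>(s, u)\<in>?bd ` P. le_flag s t u)"
      proof (rule ex_between_flagged)
        fix s l s' u assume "(s, l) \<in> ?bd ` N" "(s', u) \<in> ?bd ` P"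
        then obtain n p where n: "n \<in> N" "s = fst n" "l = - r n / cf n"
          and p: "p \<in> P" "s' = fst p" "u = - r p / cf p"
          by blast
        have cf: "cf n < 0" "0 < cf p"
          using n(1) p(1) by (auto simp: N_def P_def)
        have "comb p n \<in> B"
          using n p by (auto simp: B_def)
        then have "sat x (comb p n)"
          by (rule xB)
        \<comment> \<open>The terms in \<open>x j\<close> cancel; division by the positive number
          \<open>- cf n * cf p\<close> then compares the two bounds.\<close>
        then have "le_flag (s \<or> s') (- cf n * r p + cf p * r n) 0"
          using n(2) p(2) by (simp add: sat_def comb_def x algebra_simps disj_commute)
        then show "le_flag (s \<or> s') l u"
          unfolding n(3) p(3) using cf by (auto simp: le_flag_def field_simps split: if_splits)
      qed (use fin in auto)
      then obtain t where t: "\<And>q. q \<in> N \<Longrightarrow> le_flag (fst q) (- r q / cf q) t"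
        "\<And>q. q \<in> P \<Longrightarrow> le_flag (fst q) t (- r q / cf q)"
        by auto
      have "sat (x(j := t)) q" if "q \<in> A" for q
      proof -
        consider "cf q = 0" | "q \<in> N" "cf q < 0" | "q \<in> P" "0 < cf q"
          using \<open>q \<in> A\<close> by (fastforce simp: N_def P_def)
        then show ?thesis
        proof cases
          case 1
          then have "sat x q"
            using \<open>q \<in> A\<close> by (intro xB) (auto simp: B_def)
          then show ?thesis
            using 1 by (simp add: sat_def r x)
        next
          case 2
          then show ?thesis
            using t(1)[of q] by (auto simp: sat_def r le_flag_def field_simps split: if_splits)
        next
          case 3
          then show ?thesis
            using t(2)[of q] by (auto simp: sat_def r le_flag_def field_simps split: if_splits)
        qed
      qed
      then show False
        using insert.prems(3) by blast
    qed
  qed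
  ultimately show ?case
    using conic_trans by blast
qed

text \<open>Motzkin's transposition theorem, obtained by eliminating all variables: for
  \<open>J = UNIV\<close> the condition on vanishing coefficients is vacuous.\<close>

lemma infeasible_certificate:
  fixes A :: "(bool \<times> ('v::finite) aff) set"
  assumes "finite A" and "\<And>x. \<exists>q\<in>A. \<not> sat x q"
  shows "\<exists>s c. (s, (\<lambda>_. 0, c)) \<in> conic A \<and> \<not> le_flag s c 0"
  by (rule infeasible_certificate_aux[of UNIV]) (use assms in auto)

section \<open>Linear domination on a polyhedron\<close>

definition poly_set :: "('v::finite) aff set \<Rightarrow> ('v \<Rightarrow> real) set" where
  "poly_set A = {x. \<forall>p\<in>A. aff p x \<le> 0}"

text \<open>The system \<open>A \<le> 0\<close>, \<open>f \<le> 0\<close>, \<open>h > 0\<close> is infeasible. A certificate either bounds \<open>h\<close> by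
  a multiple of \<open>f\<close>, or bounds \<open>f\<close> away from \<open>0\<close>; then the bound on \<open>h\<close> is used.\<close>

lemma affine_domination:
  fixes A :: "('v::finite) aff set"
  assumes "finite A"
    and bd: "\<And>x. x \<in> poly_set A \<Longrightarrow> aff h x \<le> M"
    and nonneg: "\<And>x. x \<in> poly_set A \<Longrightarrow> 0 \<le> aff f x"
    and zero: "\<And>x. x \<in> poly_set A \<Longrightarrow> aff f x = 0 \<Longrightarrow> aff h x \<le> 0"
  shows "\<exists>k. \<forall>x\<in>poly_set A. aff h x \<le> k * aff f x"
proof -
  define S where "S = insert (False, f) (insert (True, aff_scale (- 1) h) (Pair False ` A))"
  have "\<exists>q\<in>S. \<not> sat x q" for x
  proof (rule ccontr)
    assume "\<not> ?thesis"
    then have "x \<in> poly_set A" "aff f x \<le> 0" "0 < aff h x"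
      by (auto simp: S_def poly_set_def sat_def le_flag_def)
    then show False
      using nonneg[of x] zero[of x] by simp
  qed
  then obtain s c where sc: "(s, (\<lambda>_. 0, c)) \<in> conic S" "\<not> le_flag s c 0"
    using infeasible_certificate[of S] assms(1) by (auto simp: S_def)
  \<comment> \<open>Invariant of conic combinations: \<open>l\<close> and \<open>k\<close> collect
    the weights of \<open>f\<close> and of \<open>- h\<close>, while the members of \<open>A\<close>
    contribute at most 0. As \<open>- h\<close> is the only strict member of \<open>S\<close>, a
    strict combination has \<open>k > 0\<close>.\<close>
  have cone: "\<exists>l\<ge>0. \<exists>k\<ge>0. (fst q \<longrightarrow> 0 < k) \<and>
      (\<forall>x\<in>poly_set A. aff (snd q) x \<le> l * aff f x - k * aff h x)" if "q \<in> conic S" for q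
    using that
  proof induction
    case (base q)
    then consider "q = (False, f)" | "q = (True, aff_scale (- 1) h)" | "\<not> fst q" "snd q \<in> A"
      by (auto simp: S_def)
    then show ?case
    proof cases
      case 1
      then show ?thesis by (intro exI[of _ 1] conjI exI[of _ 0]) auto
    next
      case 2
      then show ?thesis by (intro exI[of _ 0] conjI exI[of _ 1]) auto
    next
      case 3
      then show ?thesis by (intro exI[of _ 0] conjI) (auto simp: poly_set_def)
    qed
  next
    case (scale s p r)
    then obtain l k where lk: "0 \<le> l" "0 \<le> k" "s \<longrightarrow> 0 < k"
      "\<forall>x\<in>poly_set A. aff p x \<le> l * aff f x - k * aff h x"
      by auto
    have "r * aff p x \<le> (r * l) * aff f x - (r * k) * aff h x" if "x \<in> poly_set A" for x
      using mult_left_mono[OF bspec[OF lk(4) that], of r] \<open>0 < r\<close> by (simp add: algebra_simps)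
    then show ?case
      using lk \<open>0 < r\<close> by (intro exI[of _ "r * l"] conjI exI[of _ "r * k"]) auto
  next
    case (add s p s' p')
    then obtain l k l' k' where lk: "0 \<le> l" "0 \<le> k" "s \<longrightarrow> 0 < k"
      "\<forall>x\<in>poly_set A. aff p x \<le> l * aff f x - k * aff h x"
      "0 \<le> l'" "0 \<le> k'" "s' \<longrightarrow> 0 < k'"
      "\<forall>x\<in>poly_set A. aff p' x \<le> l' * aff f x - k' * aff h x"
      by auto
    then have "aff p x + aff p' x \<le> (l + l') * aff f x - (k + k') * aff h x"
      if "x \<in> poly_set A" for x
      using that by (fastforce simp: algebra_simps)
    then show ?case
      using lk by (intro exI[of _ "l + l'"] conjI exI[of _ "k + k'"]) auto
  qed
  obtain l k where lk: "0 \<le> l" "0 \<le> k" "s \<longrightarrow> 0 < k"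
    "\<forall>x\<in>poly_set A. c \<le> l * aff f x - k * aff h x"
    using cone[OF sc(1)] by (auto simp: aff_def)
  have c: "0 \<le> c" "s \<or> 0 < c"
    using sc(2) by (auto simp: le_flag_def split: if_splits)
  show ?thesis
  proof (cases "k = 0")
    case False
    then have "aff h x \<le> l / k * aff f x" if "x \<in> poly_set A" for x
      using lk(2,4) c(1) that by (force simp: field_simps)
    then show ?thesis by blast
  next
    case True
    then have "0 < c"
      using lk(3) c(2) by auto
    \<comment> \<open>\<open>k = 0\<close> rules out strictness, so \<open>c > 0\<close> and
      \<open>c \<le> l * aff f x\<close>. The factor \<open>l * aff f x / c\<close> is thus at least
      1, and multiplying it by \<open>\<bar>M\<bar>\<close> dominates \<open>h\<close>.\<close>
    have "aff h x \<le> (\<bar>M\<bar> * l / c) * aff f x" if "x \<in> poly_set A" for x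
    proof -
      have "\<bar>M\<bar> * c \<le> \<bar>M\<bar> * (l * aff f x)"
        using lk(4) True that by (intro mult_left_mono) auto
      then have "\<bar>M\<bar> \<le> (\<bar>M\<bar> * l / c) * aff f x"
        using \<open>0 < c\<close> by (simp add: field_simps)
      then show ?thesis
        using bd[OF that] by linarith
    qed
    then show ?thesis by blast
  qed
qed


section \<open>Piecewise affine functions\<close>

definition piecewise_affine :: "(('v::finite \<Rightarrow> real) \<Rightarrow> real) \<Rightarrow> bool" where
  "piecewise_affine F \<longleftrightarrow> (\<exists>\<P>. finite \<P> \<and>
     (\<forall>(A, p)\<in>\<P>. finite A \<and> (\<forall>x\<in>poly_set A. F x = aff p x)) \<and>
     (\<forall>x. \<exists>(A, p)\<in>\<P>. x \<in> poly_set A))"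

lemma poly_set_Un: "poly_set (A \<union> B) = poly_set A \<inter> poly_set B"
  by (auto simp: poly_set_def)

lemma poly_set_insert: "poly_set (insert p A) = {x. aff p x \<le> 0} \<inter> poly_set A"
  by (auto simp: poly_set_def)

lemma piecewise_affine_aff: "piecewise_affine (aff p)"
  unfolding piecewise_affine_def
  by (intro exI[of _ "{({}, p)}"]) (auto simp: poly_set_def)

lemma piecewise_affine_diff:
  assumes "piecewise_affine F" "piecewise_affine G"
  shows "piecewise_affine (\<lambda>x. F x - G x)"
proof -
  obtain \<P> where P: "finite \<P>" "\<And>A p. (A, p) \<in> \<P> \<Longrightarrow> finite A"
    "\<And>A p x. (A, p) \<in> \<P> \<Longrightarrow> x \<in> poly_set A \<Longrightarrow> F x = aff p x"
    "\<And>x. \<exists>A p. (A, p) \<in> \<P> \<and> x \<in> poly_set A"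
    using assms(1) unfolding piecewise_affine_def by fast
  obtain \<Q> where Q: "finite \<Q>" "\<And>A p. (A, p) \<in> \<Q> \<Longrightarrow> finite A"
    "\<And>A p x. (A, p) \<in> \<Q> \<Longrightarrow> x \<in> poly_set A \<Longrightarrow> G x = aff p x"
    "\<And>x. \<exists>A p. (A, p) \<in> \<Q> \<and> x \<in> poly_set A"
    using assms(2) unfolding piecewise_affine_def by fast
  \<comment> \<open>Common refinement: uniting two systems intersects their polyhedra.\<close>
  let ?g = "\<lambda>((A, p), (B, q)). (A \<union> B, aff_diff p q)"
  have "\<exists>(C, r)\<in>?g ` (\<P> \<times> \<Q>). x \<in> poly_set C" for x
  proof -
    obtain A p B q where "(A, p) \<in> \<P>" "x \<in> poly_set A" "(B, q) \<in> \<Q>" "x \<in> poly_set B"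
      using P(4) Q(4) by meson
    then show ?thesis
      by (force simp: poly_set_Un)
  qed
  then show ?thesis
    unfolding piecewise_affine_def using P(1-3) Q(1-3)
    by (intro exI[of _ "?g ` (\<P> \<times> \<Q>)"]) (auto simp: poly_set_Un)
qed

lemma piecewise_affine_max:
  assumes "piecewise_affine F" "piecewise_affine G"
  shows "piecewise_affine (\<lambda>x. max (F x) (G x))"
proof -
  obtain \<P> where P: "finite \<P>" "\<And>A p. (A, p) \<in> \<P> \<Longrightarrow> finite A"
    "\<And>A p x. (A, p) \<in> \<P> \<Longrightarrow> x \<in> poly_set A \<Longrightarrow> F x = aff p x"
    "\<And>x. \<exists>A p. (A, p) \<in> \<P> \<and> x \<in> poly_set A"
    using assms(1) unfolding piecewise_affine_def by fast
  obtain \<Q> where Q: "finite \<Q>" "\<And>A p. (A, p) \<in> \<Q> \<Longrightarrow> finite A"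
    "\<And>A p x. (A, p) \<in> \<Q> \<Longrightarrow> x \<in> poly_set A \<Longrightarrow> G x = aff p x"
    "\<And>x. \<exists>A p. (A, p) \<in> \<Q> \<and> x \<in> poly_set A"
    using assms(2) unfolding piecewise_affine_def by fast
  \<comment> \<open>Each cell of the common refinement is cut along \<open>p = q\<close>;
    \<open>?f\<close> keeps the closed half where \<open>p\<close> is the maximum, \<open>?g\<close>
    the one where \<open>q\<close> is.\<close>
  let ?f = "\<lambda>((A, p), (B, q)). (insert (aff_diff q p) (A \<union> B), p)"
  let ?g = "\<lambda>((A, p), (B, q)). (insert (aff_diff p q) (A \<union> B), q)"
  let ?R = "?f ` (\<P> \<times> \<Q>) \<union> ?g ` (\<P> \<times> \<Q>)"
  have "\<exists>(C, r)\<in>?R. x \<in> poly_set C" for x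
  proof -
    obtain A p B q where *: "(A, p) \<in> \<P>" "x \<in> poly_set A" "(B, q) \<in> \<Q>" "x \<in> poly_set B"
      using P(4) Q(4) by meson
    then have "?f ((A, p), (B, q)) \<in> ?R" "?g ((A, p), (B, q)) \<in> ?R"
      by blast+
    moreover have "x \<in> poly_set (fst (?f ((A, p), (B, q)))) \<or> x \<in> poly_set (fst (?g ((A, p), (B, q))))"
      using * by (auto simp: poly_set_Un poly_set_insert)
    ultimately show ?thesis
      by (metis (no_types, lifting) case_prod_beta)
  qed
  then show ?thesis
    unfolding piecewise_affine_def using P(1-3) Q(1-3)
    by (intro exI[of _ ?R]) (auto simp: poly_set_Un poly_set_insert)
qed

lemma piecewise_affine_abs:
  assumes "piecewise_affine F"
  shows "piecewise_affine (\<lambda>x. \<bar>F x\<bar>)"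
proof -
  have "piecewise_affine (\<lambda>x. max (F x) (aff (\<lambda>_. 0, 0) x - F x))"
    by (intro piecewise_affine_max piecewise_affine_diff piecewise_affine_aff assms)
  moreover have "max (F x) (aff (\<lambda>_. 0, 0) x - F x) = \<bar>F x\<bar>" for x
    by (simp add: aff_def abs_real_def max_def)
  ultimately show ?thesis by simp
qed

text \<open>Each of the finitely many common cells has a constant by
  \<open>affine_domination\<close>; since \<open>F\<close> is nonnegative, all of them may be
  enlarged to one natural number.\<close>

lemma piecewise_affine_domination:
  assumes "piecewise_affine F" "piecewise_affine H"
    and nonneg: "\<And>x. 0 \<le> F x"
    and bd: "\<And>x. H x \<le> M"
    and zero: "\<And>x. F x = 0 \<Longrightarrow> H x \<le> 0"
  shows "\<exists>k::nat. \<forall>x. H x \<le> k * F x"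
proof -
  obtain \<P> where P: "finite \<P>" "\<And>A p. (A, p) \<in> \<P> \<Longrightarrow> finite A"
    "\<And>A p x. (A, p) \<in> \<P> \<Longrightarrow> x \<in> poly_set A \<Longrightarrow> F x = aff p x"
    "\<And>x. \<exists>A p. (A, p) \<in> \<P> \<and> x \<in> poly_set A"
    using assms(1) unfolding piecewise_affine_def by fast
  obtain \<Q> where Q: "finite \<Q>" "\<And>A p. (A, p) \<in> \<Q> \<Longrightarrow> finite A"
    "\<And>A p x. (A, p) \<in> \<Q> \<Longrightarrow> x \<in> poly_set A \<Longrightarrow> H x = aff p x"
    "\<And>x. \<exists>A p. (A, p) \<in> \<Q> \<and> x \<in> poly_set A"
    using assms(2) unfolding piecewise_affine_def by fast
  have "\<exists>k. \<forall>x\<in>poly_set (fst a \<union> fst b). H x \<le> k * F x" if "a \<in> \<P>" "b \<in> \<Q>" for a b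
  proof -
    obtain A p B q where ab: "a = (A, p)" "b = (B, q)"
      by (metis surj_pair)
    have F: "aff p x = F x" and H: "aff q x = H x" if "x \<in> poly_set (A \<union> B)" for x
      using that P(3)[of A p x] Q(3)[of B q x] \<open>a \<in> \<P>\<close> \<open>b \<in> \<Q>\<close> by (auto simp: ab poly_set_Un)
    have "\<exists>k. \<forall>x\<in>poly_set (A \<union> B). aff q x \<le> k * aff p x"
      using P(2)[of A p] Q(2)[of B q] that bd nonneg zero
      by (intro affine_domination[of _ q M p]) (auto simp: ab F H)
    then show ?thesis
      by (auto simp: ab F H)
  qed
  then obtain k where k: "\<And>a b x. a \<in> \<P> \<Longrightarrow> b \<in> \<Q> \<Longrightarrow> x \<in> poly_set (fst a \<union> fst b)
      \<Longrightarrow> H x \<le> k a b * F x"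
    by metis
  \<comment> \<open>A sum of absolute values bounds every local constant from above.\<close>
  define m where "m = (\<Sum>a\<in>\<P>. \<Sum>b\<in>\<Q>. \<bar>k a b\<bar>)"
  have m: "k a b \<le> m" if "a \<in> \<P>" "b \<in> \<Q>" for a b
  proof -
    have "k a b \<le> (\<Sum>b\<in>\<Q>. \<bar>k a b\<bar>)"
      using member_le_sum[of b \<Q> "\<lambda>b. \<bar>k a b\<bar>"] that(2) Q(1) by simp
    also have "\<dots> \<le> m"
      unfolding m_def
      using member_le_sum[of a \<P> "\<lambda>a. \<Sum>b\<in>\<Q>. \<bar>k a b\<bar>"] that(1) P(1) by (simp add: sum_nonneg)
    finally show ?thesis .
  qed
  have "H x \<le> nat \<lceil>m\<rceil> * F x" for x
  proof -
    obtain A p B q where *: "(A, p) \<in> \<P>" "x \<in> poly_set A" "(B, q) \<in> \<Q>" "x \<in> poly_set B"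
      using P(4) Q(4) by meson
    then have "H x \<le> k (A, p) (B, q) * F x"
      by (intro k) (auto simp: poly_set_Un)
    also have "\<dots> \<le> nat \<lceil>m\<rceil> * F x"
      using m[OF *(1,3)] nonneg[of x] by (intro mult_right_mono) linarith+
    finally show ?thesis .
  qed
  then show ?thesis by blast
qed


section \<open>Values of rational functions\<close>

lemma val_times [simp]: "val (a * b) = val a + val b"
  by (cases a; cases b) auto

lemma val_plus [simp]: "val (a + b) = max (val a) (val b)"
  by (auto simp: plus_supertrop_def nu_def)

lemma val_star [simp]: "val (star a) = - val a"
  by (cases a) auto

lemma val_one [simp]: "val 1 = 0"
  by (simp add: one_supertrop_def)

lemma val_power [simp]: "val (a ^ k) = k * val a"
  by (induction k) (auto simp: algebra_simps)

lemma val_prod [simp]: "val (prod f A) = (\<Sum>i\<in>A. val (f i))"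
  by (induction A rule: infinite_finite_induct) auto

lemma val_sum1: "xs \<noteq> [] \<Longrightarrow> val (sum1 xs) = Max (val ` set xs)"
  by (induction xs rule: sum1.induct) auto

lemma nu_eq_iff [simp]: "a \<cong>\<^sub>\<nu> b \<longleftrightarrow> val a = val b"
  by (simp add: nu_eq_def nu_def)

lemma fun_nu_eq_iff [simp]: "f \<approx>\<^sub>\<nu> g \<longleftrightarrow> (\<forall>a. val (f a) = val (g a))"
  by (simp add: fun_nu_eq_def)

section \<open>Max-plus monomials and polynomials\<close>

definition tmon :: "real \<times> ('n::finite \<Rightarrow> nat) \<Rightarrow> ('n \<Rightarrow> real) \<Rightarrow> real" where
  "tmon m x = fst m + (\<Sum>i\<in>UNIV. real (snd m i) * x i)"

text \<open>Exponent vectors may repeat in \<open>M\<close>, unlike in \<open>poly_funs\<close>;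
  this way the maximum of two polynomials is simply the union of their monomial sets.\<close>

definition tpolys :: "(('n::finite \<Rightarrow> real) \<Rightarrow> real) set" where
  "tpolys = {\<lambda>x. Max ((\<lambda>m. tmon m x) ` M) | M. finite M \<and> M \<noteq> {}}"

lemma tpolysI:
  assumes "finite M" "M \<noteq> {}" "\<And>x. P x = Max ((\<lambda>m. tmon m x) ` M)"
  shows "P \<in> tpolys"
proof -
  have "P = (\<lambda>x. Max ((\<lambda>m. tmon m x) ` M))"
    using assms(3) by blast
  then show ?thesis
    using assms(1,2) unfolding tpolys_def by blast
qed

lemma tpolys_tmon: "tmon m \<in> tpolys"
  by (rule tpolysI[of "{m}"]) auto

lemma tpolys_max:
  assumes "P \<in> tpolys" "Q \<in> tpolys"
  shows "(\<lambda>x. max (P x) (Q x)) \<in> tpolys"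
proof -
  obtain M N where "finite M" "M \<noteq> {}" "P = (\<lambda>x. Max ((\<lambda>m. tmon m x) ` M))"
    and "finite N" "N \<noteq> {}" "Q = (\<lambda>x. Max ((\<lambda>m. tmon m x) ` N))"
    using assms unfolding tpolys_def by blast
  then show ?thesis
    by (intro tpolysI[of "M \<union> N"]) (auto simp: image_Un Max_Un)
qed

text \<open>Monomials are added one at a time, so that closure properties reduce to a single
  monomial and a binary maximum.\<close>

lemma tpolys_induct [consumes 1, case_names tmon max]:
  assumes "P \<in> tpolys"
    and base: "\<And>m. R (tmon m)"
    and step: "\<And>m P. P \<in> tpolys \<Longrightarrow> R P \<Longrightarrow> R (\<lambda>x. max (tmon m x) (P x))"
  shows "R P"
proof -
  obtain M where M: "finite M" "M \<noteq> {}" "P = (\<lambda>x. Max ((\<lambda>m. tmon m x) ` M))"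
    using assms(1) unfolding tpolys_def by blast
  from M(1,2) have "R (\<lambda>x. Max ((\<lambda>m. tmon m x) ` M))"
  proof (induction rule: finite_ne_induct)
    case (singleton m)
    then show ?case
      using base[of m] by simp
  next
    case (insert m M)
    have "(\<lambda>x. Max ((\<lambda>m. tmon m x) ` M)) \<in> tpolys"
      using insert.hyps by (intro tpolysI[of M]) auto
    from step[OF this insert.IH, of m] show ?case
      using insert.hyps by simp
  qed
  then show ?thesis
    using M(3) by simp
qed

lemma tmon_add_in_tpolys:
  assumes "Q \<in> tpolys"
  shows "(\<lambda>x. tmon m x + Q x) \<in> tpolys"
  using assms
proof (induction rule: tpolys_induct)
  case (tmon m')
  have "(\<lambda>x. tmon m x + tmon m' x) = tmon (fst m + fst m', \<lambda>i. snd m i + snd m' i)"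
    by (simp add: fun_eq_iff tmon_def sum.distrib algebra_simps)
  then show ?case
    by (simp add: tpolys_tmon)
next
  case (max m' P)
  have "tmon (fst m + fst m', \<lambda>i. snd m i + snd m' i) x = tmon m x + tmon m' x" for x
    by (simp add: tmon_def sum.distrib algebra_simps)
  then have "(\<lambda>x. max (tmon m x + tmon m' x) (tmon m x + P x)) \<in> tpolys"
    using tpolys_max[OF tpolys_tmon max.IH, of "(fst m + fst m', \<lambda>i. snd m i + snd m' i)"] by simp
  then show ?case
    by (simp add: max_add_distrib_right)
qed

text \<open>Max-plus multiplication: addition distributes over the maximum, and the sum of two
  monomials is a monomial.\<close>

lemma tpolys_add:
  assumes "P \<in> tpolys" "Q \<in> tpolys"
  shows "(\<lambda>x. P x + Q x) \<in> tpolys"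
  using assms(1)
proof (induction rule: tpolys_induct)
  case (tmon m)
  show ?case
    by (rule tmon_add_in_tpolys[OF assms(2)])
next
  case (max m P)
  from tpolys_max[OF tmon_add_in_tpolys[OF assms(2)] max.IH] show ?case
    by (simp add: max_add_distrib_left)
qed

lemma piecewise_affine_tpolys:
  assumes "P \<in> tpolys"
  shows "piecewise_affine P"
proof -
  have tmon: "piecewise_affine (tmon m)" for m :: "real \<times> ('a \<Rightarrow> nat)"
  proof -
    have "tmon m = aff (\<lambda>i. real (snd m i), fst m)"
      by (simp add: fun_eq_iff tmon_def aff_def)
    then show ?thesis
      by (simp add: piecewise_affine_aff)
  qed
  from assms show ?thesis
    by (induction rule: tpolys_induct) (auto intro: tmon piecewise_affine_max)
qed

section \<open>From supertropical to max-plus polynomials and back\<close>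

abbreviation pmon :: "('n::finite) point \<Rightarrow> supertrop \<times> ('n \<Rightarrow> nat) \<Rightarrow> supertrop" where
  "pmon a \<equiv> \<lambda>(c, e). c * (\<Prod>i\<in>UNIV. a i ^ e i)"

lemma val_pmon: "val (pmon a m) = tmon (val (fst m), snd m) (\<lambda>i. val (a i))"
  by (simp add: case_prod_beta tmon_def)

text \<open>\<open>val\<close> turns products into sums and sums into maxima, so the value at a
  point depends only on the values of its coordinates, not on which of them are ghosts.\<close>

lemma poly_funs_val:
  fixes f :: "('n::finite) sfun"
  assumes "f \<in> poly_funs C"
  obtains P where "P \<in> tpolys" "\<And>a. val (f a) = P (\<lambda>i. val (a i))"
proof -
  obtain ms :: "(supertrop \<times> ('n \<Rightarrow> nat)) list"
    where ms: "ms \<noteq> []" "f = (\<lambda>a. sum1 (map (pmon a) ms))"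
    using assms unfolding poly_funs_def by blast
  let ?M = "(\<lambda>m. (val (fst m), snd m)) ` set ms"
  let ?P = "\<lambda>x. Max ((\<lambda>m. tmon m x) ` ?M)"
  have "?P \<in> tpolys"
    using ms(1) by (intro tpolysI[of ?M]) auto
  moreover have "val (f a) = ?P (\<lambda>i. val (a i))" for a
    using ms by (simp add: val_sum1 image_image val_pmon)
  ultimately show ?thesis
    by (rule that)
qed

text \<open>Repeated exponents are merged by keeping the largest coefficient.\<close>

lemma tpolys_realized:
  fixes P :: "('n::finite \<Rightarrow> real) \<Rightarrow> real"
  assumes "P \<in> tpolys"
  obtains f where "f \<in> poly_funs (range Tangible)" "\<And>a. val (f a) = P (\<lambda>i. val (a i))"
proof -
  obtain M where M: "finite M" "M \<noteq> {}" "P = (\<lambda>x. Max ((\<lambda>m. tmon m x) ` M))"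
    using assms unfolding tpolys_def by blast
  \<comment> \<open>A maximum over a nonempty set whenever \<open>e\<close> is an exponent occurring
    in \<open>M\<close>, and it is used only for such \<open>e\<close>.\<close>
  define top where "top e = Max {c. (c, e) \<in> M}" for e
  have fin: "finite {c. (c, e) \<in> M}" for e
    by (rule finite_subset[of _ "fst ` M"]) (use M(1) in force)+
  obtain es where es: "set es = snd ` M" "distinct es"
    using finite_distinct_list[of "snd ` M"] M(1) by auto
  have "es \<noteq> []"
    using es(1) M(2) by auto
  \<comment> \<open>Tangible coefficients allow the result to serve as a denominator as well as a
    numerator.\<close>
  define ms where "ms = map (\<lambda>e. (Tangible (top e), e)) es"
  define f :: "'n sfun" where "f = (\<lambda>a. sum1 (map (pmon a) ms))"
  have "map snd ms = es"
    by (simp add: ms_def comp_def)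
  then have "f \<in> poly_funs (range Tangible)"
    unfolding poly_funs_def f_def using es(2) \<open>es \<noteq> []\<close>
    by (intro CollectI exI[of _ ms]) (auto simp: ms_def)
  moreover have "val (f a) = P (\<lambda>i. val (a i))" for a
  proof -
    let ?x = "\<lambda>i. val (a i)"
    have "val (f a) = Max ((\<lambda>e. tmon (top e, e) ?x) ` snd ` M)"
      using \<open>es \<noteq> []\<close> by (simp add: f_def ms_def val_sum1 image_image tmon_def flip: es(1))
    also have "\<dots> = Max ((\<lambda>m. tmon m ?x) ` M)"
    \<comment> \<open>Every merged monomial already belongs to \<open>M\<close>; conversely each
      monomial of \<open>M\<close> lies below the merged one with the same exponents.\<close>
    proof (rule antisym)
      have "(top (snd m), snd m) \<in> M" if "m \<in> M" for m
      proof -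
        have "Max {c. (c, snd m) \<in> M} \<in> {c. (c, snd m) \<in> M}"
          by (rule Max_in[OF fin]) (use that in \<open>auto intro: exI[of _ "fst m"]\<close>)
        then show ?thesis
          by (simp add: top_def)
      qed
      then show "Max ((\<lambda>e. tmon (top e, e) ?x) ` snd ` M) \<le> Max ((\<lambda>m. tmon m ?x) ` M)"
        using M(1,2) by (intro Max_mono) auto
      have "tmon m ?x \<le> Max ((\<lambda>e. tmon (top e, e) ?x) ` snd ` M)" if "m \<in> M" for m
      proof -
        have "fst m \<le> top (snd m)"
          unfolding top_def using that by (intro Max_ge fin) simp
        then have "tmon m ?x \<le> tmon (top (snd m), snd m) ?x"
          by (simp add: tmon_def)
        also have "\<dots> \<le> Max ((\<lambda>e. tmon (top e, e) ?x) ` snd ` M)"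
          using M(1) that by (intro Max_ge) auto
        finally show ?thesis .
      qed
      then show "Max ((\<lambda>m. tmon m ?x) ` M) \<le> Max ((\<lambda>e. tmon (top e, e) ?x) ` snd ` M)"
        using M(1,2) by simp
    qed
    finally show ?thesis
      by (simp add: M(3))
  qed
  ultimately show ?thesis
    by (rule that)
qed

section \<open>Real-valued functions represented by rational functions\<close>

text \<open>Kernels see functions only through their values, and a pointwise sum need not be
  rational itself. Operations are therefore performed on \<open>F\<close>, followed by the choice of
  a rational representative.\<close>

definition realizes :: "('n::finite) sfun \<Rightarrow> ('n point \<Rightarrow> real) \<Rightarrow> bool" where
  "realizes f F \<longleftrightarrow> f \<in> rat_funs \<and> (\<forall>a. val (f a) = F a)"

lemma rat_funs_val:
  assumes "f \<in> rat_funs"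
  obtains P Q where "P \<in> tpolys" "Q \<in> tpolys"
    "\<And>a. val (f a) = P (\<lambda>i. val (a i)) - Q (\<lambda>i. val (a i))"
proof -
  obtain h g where hg: "f = (\<lambda>a. h a * star (g a))" "h \<in> poly_funs UNIV"
    "g \<in> poly_funs (range Tangible)"
    using assms unfolding rat_funs_def by blast
  obtain P where P: "P \<in> tpolys" "\<And>a. val (h a) = P (\<lambda>i. val (a i))"
    using poly_funs_val[OF hg(2)] by blast
  obtain Q where Q: "Q \<in> tpolys" "\<And>a. val (g a) = Q (\<lambda>i. val (a i))"
    using poly_funs_val[OF hg(3)] by blast
  show ?thesis
    by (rule that[OF P(1) Q(1)]) (simp add: hg(1) P(2) Q(2))
qed

lemma poly_funs_mono: "C \<subseteq> D \<Longrightarrow> poly_funs C \<subseteq> poly_funs D"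
  unfolding poly_funs_def by blast

text \<open>Converse of \<open>rat_funs_val\<close>: the values of rational functions are exactly
  the differences of max-plus polynomials.\<close>

lemma ex_realizes_tpolys_diff:
  assumes "P \<in> tpolys" "Q \<in> tpolys"
    and "\<And>a. F a = P (\<lambda>i. val (a i)) - Q (\<lambda>i. val (a i))"
  shows "\<exists>f. realizes f F"
proof -
  obtain h where h: "h \<in> poly_funs (range Tangible)" "\<And>a. val (h a) = P (\<lambda>i. val (a i))"
    using tpolys_realized[OF assms(1)] by blast
  obtain g where g: "g \<in> poly_funs (range Tangible)" "\<And>a. val (g a) = Q (\<lambda>i. val (a i))"
    using tpolys_realized[OF assms(2)] by blast
  have "(\<lambda>a. h a * star (g a)) \<in> rat_funs"
    unfolding rat_funs_def using g(1) h(1) poly_funs_mono[of "range Tangible" UNIV] by blast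
  then have "realizes (\<lambda>a. h a * star (g a)) F"
    by (simp add: realizes_def assms(3) g(2) h(2))
  then show ?thesis by blast
qed

lemma realizes_self: "f \<in> rat_funs \<Longrightarrow> realizes f (\<lambda>a. val (f a))"
  by (simp add: realizes_def)

lemma ex_realizes_uminus:
  assumes "realizes f F"
  shows "\<exists>f'. realizes f' (\<lambda>a. - F a)"
proof -
  obtain P Q where PQ: "P \<in> tpolys" "Q \<in> tpolys"
    "\<And>a. val (f a) = P (\<lambda>i. val (a i)) - Q (\<lambda>i. val (a i))"
    using rat_funs_val assms unfolding realizes_def by metis
  have "- F a = Q (\<lambda>i. val (a i)) - P (\<lambda>i. val (a i))" for a
    using assms PQ(3)[of a] by (simp add: realizes_def)
  then show ?thesis
    by (rule ex_realizes_tpolys_diff[OF PQ(2,1)])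
qed

lemma ex_realizes_add:
  assumes "realizes f F" "realizes g G"
  shows "\<exists>f'. realizes f' (\<lambda>a. F a + G a)"
proof -
  obtain P Q where PQ: "P \<in> tpolys" "Q \<in> tpolys"
    "\<And>a. val (f a) = P (\<lambda>i. val (a i)) - Q (\<lambda>i. val (a i))"
    using rat_funs_val assms(1) unfolding realizes_def by metis
  obtain P' Q' where PQ': "P' \<in> tpolys" "Q' \<in> tpolys"
    "\<And>a. val (g a) = P' (\<lambda>i. val (a i)) - Q' (\<lambda>i. val (a i))"
    using rat_funs_val assms(2) unfolding realizes_def by metis
  have "F a + G a = (P (\<lambda>i. val (a i)) + P' (\<lambda>i. val (a i)))
      - (Q (\<lambda>i. val (a i)) + Q' (\<lambda>i. val (a i)))" for a
    using assms PQ(3)[of a] PQ'(3)[of a] by (simp add: realizes_def)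
  then show ?thesis
    by (rule ex_realizes_tpolys_diff[OF tpolys_add[OF PQ(1) PQ'(1)] tpolys_add[OF PQ(2) PQ'(2)]])
qed

lemma ex_realizes_max:
  assumes "realizes f F" "realizes g G"
  shows "\<exists>f'. realizes f' (\<lambda>a. max (F a) (G a))"
proof -
  obtain P Q where PQ: "P \<in> tpolys" "Q \<in> tpolys"
    "\<And>a. val (f a) = P (\<lambda>i. val (a i)) - Q (\<lambda>i. val (a i))"
    using rat_funs_val assms(1) unfolding realizes_def by metis
  obtain P' Q' where PQ': "P' \<in> tpolys" "Q' \<in> tpolys"
    "\<And>a. val (g a) = P' (\<lambda>i. val (a i)) - Q' (\<lambda>i. val (a i))"
    using rat_funs_val assms(2) unfolding realizes_def by metis
  \<comment> \<open>Both fractions are brought to the common denominator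
    \<open>Q + Q'\<close>.\<close>
  have "max (F a) (G a) = max (P (\<lambda>i. val (a i)) + Q' (\<lambda>i. val (a i)))
      (P' (\<lambda>i. val (a i)) + Q (\<lambda>i. val (a i))) - (Q (\<lambda>i. val (a i)) + Q' (\<lambda>i. val (a i)))" for a
    using assms PQ(3)[of a] PQ'(3)[of a] by (simp add: realizes_def max_def)
  then show ?thesis
    by (rule ex_realizes_tpolys_diff[OF tpolys_max[OF tpolys_add[OF PQ(1) PQ'(2)]
          tpolys_add[OF PQ'(1) PQ(2)]] tpolys_add[OF PQ(2) PQ'(2)]])
qed

lemma const_in_rat_funs: "(\<lambda>_::('n::finite) point. c) \<in> rat_funs"
proof -
  have poly: "(\<lambda>_::'n point. d) \<in> poly_funs D" if "d \<in> D" for d D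
    unfolding poly_funs_def using that
    by (intro CollectI exI[of _ "[(d, \<lambda>_. 0)]"]) (auto simp: mult.commute[of _ 1])
  have "star 1 = 1"
    by (simp add: one_supertrop_def)
  then have "c = c * star 1"
    by (simp add: mult.commute[of _ 1])
  moreover have "(\<lambda>_::'n point. c) \<in> poly_funs UNIV" "(\<lambda>_::'n point. 1) \<in> poly_funs (range Tangible)"
    by (auto intro!: poly simp: one_supertrop_def)
  ultimately show ?thesis
    unfolding rat_funs_def by fastforce
qed

lemma realizes_const: "realizes (\<lambda>_. Tangible c) (\<lambda>_. c)"
  by (simp add: realizes_def const_in_rat_funs)

text \<open>A Lojasiewicz inequality with exponent one for bounded \<open>h\<close>; piecewise
  linearity is what makes the exponent one sufficient.\<close>

lemma rat_funs_domination:
  fixes f h :: "('n::finite) sfun"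
  assumes "f \<in> rat_funs" "h \<in> rat_funs"
    and bd: "\<And>a. \<bar>val (h a)\<bar> \<le> M"
    and zero: "\<And>a. val (f a) = 0 \<Longrightarrow> val (h a) = 0"
  shows "\<exists>k::nat. \<forall>a. \<bar>val (h a)\<bar> \<le> k * \<bar>val (f a)\<bar>"
proof -
  obtain P Q where PQ: "P \<in> tpolys" "Q \<in> tpolys"
    "\<And>a. val (f a) = P (\<lambda>i. val (a i)) - Q (\<lambda>i. val (a i))"
    using rat_funs_val[OF assms(1)] by blast
  obtain P' Q' where PQ': "P' \<in> tpolys" "Q' \<in> tpolys"
    "\<And>a. val (h a) = P' (\<lambda>i. val (a i)) - Q' (\<lambda>i. val (a i))"
    using rat_funs_val[OF assms(2)] by blast
  let ?F = "\<lambda>x. \<bar>P x - Q x\<bar>" and ?H = "\<lambda>x. \<bar>P' x - Q' x\<bar>"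
  \<comment> \<open>Only coordinate values matter, so tangible points carry all the information and
    the problem moves to real space.\<close>
  have F: "?F x = \<bar>val (f (\<lambda>i. Tangible (x i)))\<bar>" and H: "?H x = \<bar>val (h (\<lambda>i. Tangible (x i)))\<bar>" for x
    by (simp_all add: PQ(3) PQ'(3))
  have "\<exists>k::nat. \<forall>x. ?H x \<le> k * ?F x"
  proof (rule piecewise_affine_domination)
    show "piecewise_affine ?F" "piecewise_affine ?H"
      by (intro piecewise_affine_abs piecewise_affine_diff piecewise_affine_tpolys PQ(1,2) PQ'(1,2))+
    show "?H x \<le> M" for x
      unfolding H by (rule bd)
    show "?H x \<le> 0" if "?F x = 0" for x
      using that zero unfolding F H by simp
  qed auto
  then show ?thesis
    by (auto simp: PQ(3) PQ'(3))
qed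


section \<open>Kernels as convex subgroups\<close>

lemma nu_class_iff: "g \<in> nu_class f \<longleftrightarrow> realizes g (\<lambda>a. val (f a))"
  by (simp add: nu_class_def realizes_def)

lemma nu_kernel_mult:
  assumes "nu_kernel K" "f \<in> K" "g \<in> K" "realizes h (\<lambda>a. val (f a) + val (g a))"
  shows "h \<in> K"
proof -
  have "h \<in> nu_class (\<lambda>a. f a * g a)"
    using assms(4) by (simp add: nu_class_iff)
  then show ?thesis
    using assms(1-3) unfolding nu_kernel_def by blast
qed

lemma nu_kernel_star:
  assumes "nu_kernel K" "f \<in> K" "realizes h (\<lambda>a. - val (f a))"
  shows "h \<in> K"
proof -
  have "h \<in> nu_class (\<lambda>a. star (f a))"
    using assms(3) by (simp add: nu_class_iff)
  then show ?thesis
    using assms(1,2) unfolding nu_kernel_def by blast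
qed

lemma nu_kernel_one: "nu_kernel K \<Longrightarrow> (\<lambda>_. 1) \<in> K"
  unfolding nu_kernel_def by blast

lemma nu_kernel_rat_funs: "nu_kernel K \<Longrightarrow> f \<in> K \<Longrightarrow> f \<in> rat_funs"
  unfolding nu_kernel_def by blast

lemma nu_kernel_combine:
  assumes "nu_kernel K" "f \<in> K" "g \<in> K" "\<alpha> \<in> rat_funs" "\<beta> \<in> rat_funs"
    and "\<And>a. max (val (\<alpha> a)) (val (\<beta> a)) = 0"
    and "realizes h (\<lambda>a. max (val (\<alpha> a) + val (f a)) (val (\<beta> a) + val (g a)))"
  shows "h \<in> K"
proof -
  have "h \<in> nu_class (\<lambda>a. \<alpha> a * f a + \<beta> a * g a)"
    using assms(7) by (simp add: nu_class_iff)
  moreover have "(\<lambda>a. \<alpha> a + \<beta> a) \<approx>\<^sub>\<nu> (\<lambda>_. 1)"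
    using assms(6) by simp
  ultimately show ?thesis
    using assms(1-5) unfolding nu_kernel_def by blast
qed

text \<open>Both weights are the constant 1, which is allowed because \<open>1 + 1\<close> has value
  0.\<close>

lemma nu_kernel_max:
  assumes "nu_kernel K" "f \<in> K" "g \<in> K" "realizes h (\<lambda>a. max (val (f a)) (val (g a)))"
  shows "h \<in> K"
  by (rule nu_kernel_combine[OF assms(1-3) const_in_rat_funs[of 1] const_in_rat_funs[of 1]])
    (use assms(4) in auto)

lemma nu_kernel_abs:
  assumes "nu_kernel K" "f \<in> K"
  obtains h where "h \<in> K" "\<And>a. val (h a) = \<bar>val (f a)\<bar>"
proof -
  have f: "realizes f (\<lambda>a. val (f a))"
    using assms by (intro realizes_self nu_kernel_rat_funs)
  obtain f' where f': "realizes f' (\<lambda>a. - val (f a))"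
    using ex_realizes_uminus[OF f] by blast
  then have "f' \<in> K"
    by (rule nu_kernel_star[OF assms])
  obtain h where h: "realizes h (\<lambda>a. max (val (f a)) (- val (f a)))"
    using ex_realizes_max[OF f f'] by blast
  have "h \<in> K"
    by (rule nu_kernel_max[OF assms \<open>f' \<in> K\<close>]) (use h f' in \<open>simp add: realizes_def\<close>)
  moreover have "val (h a) = \<bar>val (f a)\<bar>" for a
    using h by (auto simp: realizes_def)
  ultimately show ?thesis
    by (rule that)
qed

text \<open>Convexity: if \<open>0 \<le> u \<le> f\<close> then \<open>u = max ((u - f) + f) 0\<close>, with weights
  \<open>\<alpha> = u - f\<close> and \<open>\<beta> = 0\<close> of maximum \<open>0\<close>.\<close>

lemma nu_kernel_convex_pos:
  assumes "nu_kernel K" "f \<in> K" "realizes u U"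
    and "\<And>a. 0 \<le> U a" "\<And>a. U a \<le> val (f a)"
  shows "u \<in> K"
proof -
  have f: "realizes f (\<lambda>a. val (f a))"
    using assms(1,2) by (intro realizes_self nu_kernel_rat_funs)
  obtain f' where f': "realizes f' (\<lambda>a. - val (f a))"
    using ex_realizes_uminus[OF f] by blast
  obtain \<alpha> where \<alpha>: "realizes \<alpha> (\<lambda>a. U a + - val (f a))"
    using ex_realizes_add[OF assms(3) f'] by blast
  have "val (\<alpha> a) = U a - val (f a)" for a
    using \<alpha> by (simp add: realizes_def)
  moreover have "\<alpha> \<in> rat_funs" "u \<in> rat_funs" "\<And>a. val (u a) = U a"
    using \<alpha> assms(3) by (auto simp: realizes_def)
  ultimately show ?thesis
    using assms(4,5)
    by (intro nu_kernel_combine[OF assms(1,2) nu_kernel_one[OF assms(1)] _ const_in_rat_funs[of 1], of \<alpha>])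
      (simp_all add: realizes_def)
qed

text \<open>Positive and negative parts of \<open>g\<close> both lie between 0 and
  \<open>\<bar>f\<bar>\<close>, and \<open>g\<close> is their difference.\<close>

lemma nu_kernel_convex:
  assumes "nu_kernel K" "f \<in> K" "g \<in> rat_funs" "\<And>a. \<bar>val (g a)\<bar> \<le> \<bar>val (f a)\<bar>"
  shows "g \<in> K"
proof -
  obtain h where h: "h \<in> K" "\<And>a. val (h a) = \<bar>val (f a)\<bar>"
    using nu_kernel_abs[OF assms(1,2)] by blast
  note g = realizes_self[OF assms(3)]
  obtain g' where g': "realizes g' (\<lambda>a. - val (g a))"
    using ex_realizes_uminus[OF g] by blast
  obtain u where u: "realizes u (\<lambda>a. max (val (g a)) 0)"
    using ex_realizes_max[OF g realizes_const[of 0]] by blast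
  obtain v where v: "realizes v (\<lambda>a. max (- val (g a)) 0)"
    using ex_realizes_max[OF g' realizes_const[of 0]] by blast
  obtain v' where v': "realizes v' (\<lambda>a. - max (- val (g a)) 0)"
    using ex_realizes_uminus[OF v] by blast
  have bd: "max (val (g a)) 0 \<le> val (h a)" "max (- val (g a)) 0 \<le> val (h a)" for a
    using assms(4)[of a] h(2)[of a] by auto
  have "u \<in> K" "v \<in> K"
    by (rule nu_kernel_convex_pos[OF assms(1) h(1) u] nu_kernel_convex_pos[OF assms(1) h(1) v];
        use bd in simp)+
  moreover have "v' \<in> K"
    by (rule nu_kernel_star[OF assms(1) \<open>v \<in> K\<close>]) (use v v' in \<open>simp add: realizes_def\<close>)
  moreover have "realizes g (\<lambda>a. val (u a) + val (v' a))"
    using u v' assms(3) by (simp add: realizes_def max_def)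
  ultimately show ?thesis
    using nu_kernel_mult[OF assms(1)] by blast
qed

lemma nu_kernel_power:
  assumes "nu_kernel K" "f \<in> K"
  shows "\<exists>h\<in>K. \<forall>a. val (h a) = real k * val (f a)"
proof (induction k)
  case 0
  then show ?case
    using nu_kernel_one[OF assms(1)] by (intro bexI[of _ "\<lambda>_. 1"]) auto
next
  case (Suc k)
  then obtain h where h: "h \<in> K" "\<And>a. val (h a) = real k * val (f a)"
    by blast
  obtain h' where h': "realizes h' (\<lambda>a. val (f a) + val (h a))"
    using ex_realizes_add[OF realizes_self realizes_self] nu_kernel_rat_funs[OF assms(1)] assms(2) h(1)
    by blast
  then have "h' \<in> K"
    by (rule nu_kernel_mult[OF assms h(1)])
  moreover have "val (h' a) = real (Suc k) * val (f a)" for a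
    using h' by (simp add: realizes_def h(2) algebra_simps)
  ultimately show ?case by blast
qed

section \<open>Explicit descriptions of kernels by bounds\<close>

text \<open>Every kernel operation on \<open>f\<close> and \<open>g\<close> produces some
  \<open>h\<close> with \<open>\<bar>h\<bar> \<le> \<bar>f\<bar> + \<bar>g\<bar>\<close>, so an
  additively closed family of bounds suffices. Its instances are principal kernels, the bounded
  functions and \<open>Kern Z\<close>.\<close>

lemma nu_kernel_dominated:
  fixes W :: "(('n::finite) point \<Rightarrow> real) set"
  assumes "(\<lambda>_. 0) \<in> W" "\<And>v w. v \<in> W \<Longrightarrow> w \<in> W \<Longrightarrow> (\<lambda>a. v a + w a) \<in> W"
  shows "nu_kernel {g \<in> rat_funs. \<exists>w\<in>W. \<forall>a. \<bar>val (g a)\<bar> \<le> w a}" (is "nu_kernel ?K")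
proof -
  have *: "h \<in> ?K" if "f \<in> ?K" "g \<in> ?K" "h \<in> rat_funs"
    "\<And>a. \<bar>val (h a)\<bar> \<le> \<bar>val (f a)\<bar> + \<bar>val (g a)\<bar>" for f g h
  proof -
    obtain v w where "v \<in> W" "\<forall>a. \<bar>val (f a)\<bar> \<le> v a" "w \<in> W" "\<forall>a. \<bar>val (g a)\<bar> \<le> w a"
      using \<open>f \<in> ?K\<close> \<open>g \<in> ?K\<close> by blast
    then have "\<forall>a. \<bar>val (h a)\<bar> \<le> v a + w a" "(\<lambda>a. v a + w a) \<in> W"
      using that(4) assms(2) by (auto intro: order_trans[OF _ add_mono])
    then show ?thesis
      using \<open>h \<in> rat_funs\<close> by (intro CollectI conjI bexI[of _ "\<lambda>a. v a + w a"])
  qed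
  have one: "(\<lambda>_. 1) \<in> ?K"
    using assms(1) const_in_rat_funs by auto
  have mult: "nu_class (\<lambda>a. f a * g a) \<subseteq> ?K" if "f \<in> ?K" "g \<in> ?K" for f g
    by (rule subsetI, rule *[OF that]) (auto simp: nu_class_def)
  have star: "nu_class (\<lambda>a. star (f a)) \<subseteq> ?K" if "f \<in> ?K" for f
    by (rule subsetI, rule *[OF that one]) (auto simp: nu_class_def)
  have comb: "nu_class (\<lambda>a. \<alpha> a * f a + \<beta> a * g a) \<subseteq> ?K"
    if "f \<in> ?K" "g \<in> ?K" and \<alpha>\<beta>: "(\<lambda>a. \<alpha> a + \<beta> a) \<approx>\<^sub>\<nu> (\<lambda>_. 1)" for f g \<alpha> \<beta>
  proof (rule subsetI, rule *[OF that(1,2)])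
    fix h a assume h: "h \<in> nu_class (\<lambda>a. \<alpha> a * f a + \<beta> a * g a)"
    then show "h \<in> rat_funs"
      by (simp add: nu_class_def)
    \<comment> \<open>No weight exceeds 0, which gives the upper bound; one of the weights equals 0,
      which gives the lower bound.\<close>
    have "max (val (\<alpha> a)) (val (\<beta> a)) = 0"
      using \<alpha>\<beta> by simp
    moreover have "val (h a) = max (val (\<alpha> a) + val (f a)) (val (\<beta> a) + val (g a))"
      using h by (simp add: nu_class_def)
    ultimately show "\<bar>val (h a)\<bar> \<le> \<bar>val (f a)\<bar> + \<bar>val (g a)\<bar>"
      by linarith
  qed
  show ?thesis
    unfolding nu_kernel_def using one mult star comb by blast
qed

lemma kernel_gen_least: "nu_kernel K \<Longrightarrow> S \<subseteq> K \<Longrightarrow> kernel_gen S \<subseteq> K"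
  unfolding kernel_gen_def by blast

text \<open>The multiples of \<open>\<bar>f\<bar>\<close> are closed under addition, so the
  right-hand side is a kernel. Conversely a kernel containing \<open>f\<close> contains its powers
  and, by convexity, all that they dominate.\<close>

lemma kernel_gen_singleton:
  assumes "f \<in> rat_funs"
  shows "kernel_gen {f} = {g \<in> rat_funs. \<exists>k::nat. \<forall>a. \<bar>val (g a)\<bar> \<le> k * \<bar>val (f a)\<bar>}"
    (is "_ = ?K")
proof
  let ?W = "range (\<lambda>(k::nat) a. k * \<bar>val (f a)\<bar>)"
  have "nu_kernel {g \<in> rat_funs. \<exists>w\<in>?W. \<forall>a. \<bar>val (g a)\<bar> \<le> w a}"
  proof (rule nu_kernel_dominated)
    show "(\<lambda>_. 0) \<in> ?W"
      by (rule range_eqI[of _ _ 0]) simp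
    show "(\<lambda>a. v a + w a) \<in> ?W" if vw: "v \<in> ?W" "w \<in> ?W" for v w
    proof -
      obtain k l :: nat where "v = (\<lambda>a. k * \<bar>val (f a)\<bar>)" "w = (\<lambda>a. l * \<bar>val (f a)\<bar>)"
        using vw by blast
      then show ?thesis
        by (intro range_eqI[of _ _ "k + l"]) (simp add: algebra_simps)
    qed
  qed
  then have "nu_kernel ?K"
    by simp
  moreover have "f \<in> ?K"
    using assms by (auto intro: exI[of _ 1])
  ultimately show "kernel_gen {f} \<subseteq> ?K"
    by (intro kernel_gen_least) auto
next
  show "?K \<subseteq> kernel_gen {f}"
    unfolding kernel_gen_def
  proof (intro subsetI InterI)
    fix g K assume g: "g \<in> ?K" and "K \<in> {K. nu_kernel K \<and> {f} \<subseteq> K}"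
    then have K: "nu_kernel K" "f \<in> K"
      by auto
    obtain k :: nat where k: "\<And>a. \<bar>val (g a)\<bar> \<le> k * \<bar>val (f a)\<bar>"
      using g by blast
    obtain h where h: "h \<in> K" "\<And>a. val (h a) = k * val (f a)"
      using nu_kernel_power[OF K] by blast
    show "g \<in> K"
      using g k by (intro nu_kernel_convex[OF K(1) h(1)]) (auto simp: h(2) abs_mult)
  qed
qed

lemma nu_kernel_bounded: "nu_kernel {g \<in> rat_funs. \<exists>c. \<forall>a. \<bar>val (g a)\<bar> \<le> c}"
proof -
  let ?W = "range (\<lambda>(c::real) _. c)"
  have "nu_kernel {g \<in> rat_funs. \<exists>w\<in>?W. \<forall>a. \<bar>val (g a)\<bar> \<le> w a}"
    by (rule nu_kernel_dominated) auto
  then show ?thesis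
    by simp
qed

text \<open>A function bounded by \<open>c\<close> is dominated by the constant
  \<open>Tangible c\<close>, so convexity puts it in the kernel.\<close>

lemma const_kernel_eq:
  "(const_kernel :: ('n::finite) sfun set) = {g \<in> rat_funs. \<exists>c. \<forall>a. \<bar>val (g a)\<bar> \<le> c}"
  (is "_ = ?K")
proof
  have "range (\<lambda>c _. c) \<subseteq> ?K"
    using const_in_rat_funs by auto
  with nu_kernel_bounded show "const_kernel \<subseteq> ?K"
    unfolding const_kernel_def by (rule kernel_gen_least)
next
  show "?K \<subseteq> const_kernel"
    unfolding const_kernel_def kernel_gen_def
  proof (intro subsetI InterI)
    fix g :: "'n sfun" and K
    assume g: "g \<in> ?K" and "K \<in> {K. nu_kernel K \<and> range (\<lambda>c (_::'n point). c) \<subseteq> K}"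
    then have K: "nu_kernel K" "\<And>c. (\<lambda>_. c) \<in> K"
      by auto
    obtain c where "\<And>a. \<bar>val (g a)\<bar> \<le> c"
      using g by blast
    then have "\<bar>val (g a)\<bar> \<le> \<bar>val (Tangible c)\<bar>" for a
      by (simp add: order_trans[OF _ abs_ge_self])
    then show "g \<in> K"
      using g by (intro nu_kernel_convex[OF K(1) K(2)[of "Tangible c"]]) auto
  qed
qed


section \<open>The correspondence\<close>

text \<open>Boundedness and vanishing on \<open>Z\<close> together form one domination condition,
  with \<open>\<bar>g\<bar>\<close> itself as the bound in one direction.\<close>

lemma nu_kernel_Kern: "nu_kernel (Kern Z)"
proof -
  let ?W = "{w. (\<forall>a\<in>Z. w a = 0) \<and> (\<exists>c. \<forall>a. w a \<le> (c::real))}"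
  have "nu_kernel {g \<in> rat_funs. \<exists>w\<in>?W. \<forall>a. \<bar>val (g a)\<bar> \<le> w a}"
  proof (rule nu_kernel_dominated)
    show "(\<lambda>a. v a + w a) \<in> ?W" if vw: "v \<in> ?W" "w \<in> ?W" for v w
    proof -
      obtain c d where "\<forall>a. v a \<le> c" "\<forall>a. w a \<le> d"
        using vw by blast
      then have "\<forall>a. v a + w a \<le> c + d"
        by (simp add: add_mono)
      then show ?thesis
        using vw by auto
    qed
  qed auto
  moreover have "{g \<in> rat_funs. \<exists>w\<in>?W. \<forall>a. \<bar>val (g a)\<bar> \<le> w a} = Kern Z"
  proof (intro set_eqI iffI)
    fix g assume "g \<in> {g \<in> rat_funs. \<exists>w\<in>?W. \<forall>a. \<bar>val (g a)\<bar> \<le> w a}"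
    then obtain w c where w: "g \<in> rat_funs" "\<forall>a. \<bar>val (g a)\<bar> \<le> w a" "\<forall>a\<in>Z. w a = 0" "\<forall>a. w a \<le> c"
      by blast
    have "\<bar>val (g a)\<bar> \<le> c" for a
      using w(2,4) order_trans by blast
    moreover have "val (g a) = 0" if "a \<in> Z" for a
      using w(2,3) that by (metis abs_le_zero_iff)
    ultimately show "g \<in> Kern Z"
      using w(1) by (auto simp: Kern_def const_kernel_eq)
  next
    fix g assume "g \<in> Kern Z"
    then show "g \<in> {g \<in> rat_funs. \<exists>w\<in>?W. \<forall>a. \<bar>val (g a)\<bar> \<le> w a}"
      by (auto simp: Kern_def const_kernel_eq intro!: exI[of _ "\<lambda>a. \<bar>val (g a)\<bar>"])
  qed
  ultimately show ?thesis
    by simp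
qed

lemma Kern_antimono: "Z \<subseteq> Z' \<Longrightarrow> Kern Z' \<subseteq> Kern Z"
  by (auto simp: Kern_def)

lemma one_loc_antimono: "S \<subseteq> S' \<Longrightarrow> one_loc S' \<subseteq> one_loc S"
  by (auto simp: one_loc_def)

text \<open>The usual Galois identity: \<open>Z\<close> lies in \<open>one_loc (Kern Z)\<close>,
  where every member of \<open>Kern Z\<close> still has value 0.\<close>

lemma Kern_one_loc_Kern: "Kern (one_loc (Kern Z)) = Kern Z"
  by (auto simp: Kern_def one_loc_def)

text \<open>\<open>f\<close> may be unbounded and thus outside \<open>const_kernel\<close>; its
  truncation \<open>min \<bar>f\<bar> 1\<close> is bounded and has the same zero set.\<close>

lemma Kern_one_loc_singleton:
  assumes "f \<in> rat_funs"
  obtains g where "g \<in> rat_funs" "Kern (one_loc {f}) = kernel_gen {g}" "one_loc {g} = one_loc {f}"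
proof -
  note f = realizes_self[OF assms]
  obtain f' where f': "realizes f' (\<lambda>a. - val (f a))"
    using ex_realizes_uminus[OF f] by blast
  obtain u where u: "realizes u (\<lambda>a. max (val (f a)) (- val (f a)))"
    using ex_realizes_max[OF f f'] by blast
  obtain u' where u': "realizes u' (\<lambda>a. - max (val (f a)) (- val (f a)))"
    using ex_realizes_uminus[OF u] by blast
  \<comment> \<open>The minimum is expressed by negation and maximum, the operations known to have
    rational representatives.\<close>
  obtain v where v: "realizes v (\<lambda>a. max (- max (val (f a)) (- val (f a))) (- 1))"
    using ex_realizes_max[OF u' realizes_const[of "- 1"]] by blast
  obtain g where g: "realizes g (\<lambda>a. - max (- max (val (f a)) (- val (f a))) (- 1))"
    using ex_realizes_uminus[OF v] by blast
  have g_rat: "g \<in> rat_funs" and g_val: "val (g a) = min \<bar>val (f a)\<bar> 1" for a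
    using g by (auto simp: realizes_def)
  have loc: "one_loc {g} = one_loc {f}"
    by (auto simp: one_loc_def g_val min_def)
  have "Kern (one_loc {f}) = kernel_gen {g}"
  proof (intro subset_antisym subsetI)
    fix h assume "h \<in> Kern (one_loc {f})"
    then obtain M where h: "h \<in> rat_funs" "\<And>a. \<bar>val (h a)\<bar> \<le> M"
      "\<And>a. val (f a) = 0 \<Longrightarrow> val (h a) = 0"
      by (auto simp: Kern_def const_kernel_eq one_loc_def)
    obtain k :: nat where k: "\<And>a. \<bar>val (h a)\<bar> \<le> k * \<bar>val (f a)\<bar>"
      using rat_funs_domination[OF assms h(1,2,3)] by blast
    \<comment> \<open>Where \<open>\<bar>f\<bar> \<le> 1\<close>, \<open>g\<close> agrees with
      \<open>\<bar>f\<bar>\<close> and \<open>k\<close> suffices; elsewhere \<open>g\<close> has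
      value 1 and the bound \<open>M\<close> on \<open>h\<close> suffices.\<close>
    have "\<bar>val (h a)\<bar> \<le> (k + nat \<lceil>M\<rceil>) * \<bar>val (g a)\<bar>" for a
    proof (cases "\<bar>val (f a)\<bar> \<le> 1")
      case True
      then have "\<bar>val (h a)\<bar> \<le> k * \<bar>val (g a)\<bar>"
        using k[of a] by (simp add: g_val)
      also have "\<dots> \<le> (k + nat \<lceil>M\<rceil>) * \<bar>val (g a)\<bar>"
        by (intro mult_right_mono) auto
      finally show ?thesis .
    next
      case False
      then have "\<bar>val (g a)\<bar> = 1"
        by (simp add: g_val)
      then show ?thesis
        using h(2)[of a] by simp linarith
    qed
    then show "h \<in> kernel_gen {g}"
      unfolding kernel_gen_singleton[OF g_rat] using h(1) by blast
  next
    have "g \<in> Kern (one_loc {f})"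
      unfolding Kern_def const_kernel_eq loc[symmetric] using g_rat
      by (auto simp: one_loc_def g_val intro!: exI[of _ 1])
    moreover fix h assume "h \<in> kernel_gen {g}"
    ultimately show "h \<in> Kern (one_loc {f})"
      using kernel_gen_least[OF nu_kernel_Kern] by blast
  qed
  then show ?thesis
    using that g_rat loc by blast
qed

text \<open>A function dominated by a multiple of \<open>\<bar>f\<bar>\<close> vanishes wherever
  \<open>f\<close> does.\<close>

lemma one_loc_kernel_gen_singleton:
  assumes "f \<in> rat_funs"
  shows "one_loc (kernel_gen {f}) = one_loc {f}"
proof
  have "f \<in> kernel_gen {f}"
    by (simp add: kernel_gen_def)
  then show "one_loc (kernel_gen {f}) \<subseteq> one_loc {f}"
    by (intro one_loc_antimono) simp
  show "one_loc {f} \<subseteq> one_loc (kernel_gen {f})"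
  proof
    fix a assume "a \<in> one_loc {f}"
    then have "val (f a) = 0"
      by (simp add: one_loc_def)
    then have "val (g a) = 0" if g: "g \<in> kernel_gen {f}" for g
    proof -
      obtain k :: nat where "\<bar>val (g a)\<bar> \<le> k * \<bar>val (f a)\<bar>"
        using g unfolding kernel_gen_singleton[OF assms] by blast
      then show ?thesis
        using \<open>val (f a) = 0\<close> by simp
    qed
    then show "a \<in> one_loc (kernel_gen {f})"
      by (simp add: one_loc_def)
  qed
qed

theorem theorem8p4p3:
  fixes \<Z> :: "('n::finite) point set set" and \<K> :: "'n sfun set set"
  defines "\<Z> \<equiv> {Z. principal_one_set Z}"
    and "\<K> \<equiv> {K. nu_kernel_of_const K \<and> principal_kernel K \<and> K_kernel K}"
  shows "bij_betw Kern \<Z> \<K>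
    \<and> bij_betw one_loc \<K> \<Z>
    \<and> (\<forall>Z\<in>\<Z>. one_loc (Kern Z) = Z)
    \<and> (\<forall>K\<in>\<K>. Kern (one_loc K) = K)
    \<and> (\<forall>Z\<^sub>1\<in>\<Z>. \<forall>Z\<^sub>2\<in>\<Z>. Z\<^sub>1 \<subseteq> Z\<^sub>2 \<longleftrightarrow> Kern Z\<^sub>2 \<subseteq> Kern Z\<^sub>1)"
proof -
  \<comment> \<open>The truncated generator \<open>g\<close> shows that \<open>Kern Z\<close> is
    principal and also recovers \<open>Z\<close> as its zero set.\<close>
  have Z: "Kern Z \<in> \<K>" "one_loc (Kern Z) = Z" if "Z \<in> \<Z>" for Z
  proof -
    obtain f where f: "f \<in> rat_funs" "Z = one_loc {f}"
      using \<open>Z \<in> \<Z>\<close> unfolding \<Z>_def principal_one_set_def by blast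
    obtain g where g: "g \<in> rat_funs" "Kern Z = kernel_gen {g}" "one_loc {g} = Z"
      using Kern_one_loc_singleton[OF f(1)] unfolding f(2) by blast
    show "one_loc (Kern Z) = Z"
      using g by (simp add: one_loc_kernel_gen_singleton)
    have "nu_kernel_of_const (Kern Z)"
      using nu_kernel_Kern unfolding nu_kernel_of_const_def Kern_def by blast
    moreover have "principal_kernel (Kern Z)"
      using g unfolding principal_kernel_def by blast
    moreover have "one_set Z"
      using f unfolding one_set_def by blast
    ultimately show "Kern Z \<in> \<K>"
      unfolding \<K>_def K_kernel_def by blast
  qed
  \<comment> \<open>Principality makes \<open>one_loc K\<close> a principal set, whereas
    \<open>Kern (one_loc K) = K\<close> comes from \<open>K\<close> being of the form
    \<open>Kern Z\<close>.\<close>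
  have K: "one_loc K \<in> \<Z>" "Kern (one_loc K) = K" if "K \<in> \<K>" for K
  proof -
    obtain f where "f \<in> rat_funs" "K = kernel_gen {f}"
      using \<open>K \<in> \<K>\<close> unfolding \<K>_def principal_kernel_def by blast
    then show "one_loc K \<in> \<Z>"
      unfolding \<Z>_def principal_one_set_def by (auto simp: one_loc_kernel_gen_singleton)
    obtain Z where "K = Kern Z"
      using \<open>K \<in> \<K>\<close> unfolding \<K>_def K_kernel_def by blast
    then show "Kern (one_loc K) = K"
      by (simp add: Kern_one_loc_Kern)
  qed
  have "bij_betw Kern \<Z> \<K>" "bij_betw one_loc \<K> \<Z>"
    using Z K by (auto intro!: bij_betw_byWitness[of _ one_loc] bij_betw_byWitness[of _ Kern])
  \<comment> \<open>The backward implication applies \<open>one_loc\<close> to the inclusion of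
    kernels and then uses that it inverts \<open>Kern\<close>.\<close>
  moreover have "Z\<^sub>1 \<subseteq> Z\<^sub>2 \<longleftrightarrow> Kern Z\<^sub>2 \<subseteq> Kern Z\<^sub>1" if "Z\<^sub>1 \<in> \<Z>" "Z\<^sub>2 \<in> \<Z>" for Z\<^sub>1 Z\<^sub>2
    using Kern_antimono[of Z\<^sub>1 Z\<^sub>2] one_loc_antimono[of "Kern Z\<^sub>2" "Kern Z\<^sub>1"] Z(2) that by auto
  ultimately show ?thesis
    using Z(2) K(2) by blast
qed

end
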